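(* Let $\mathfrak a_{n,m}$ be the number of $\sigma\in\mathcal{I}_n(100,120)$ with $\max(\sigma)=m$. Let $\mathfrak b_{n,k}$ be the number of words $\omega\in\mathcal W_{n,k}$ avoiding $120$ such that $\omega_i=\omega_j\neq k-1$ implies $i=j$ (no letter other than $k-1$ is repeated). Then for all integers $0<m<n$, $$\mathfrak a_{n,m}=\sum_{p=m+1}^{n}\sum_{j=0}^{m-1}\mathfrak a_{p-1,j}\,\mathfrak b_{n-p,m-j+1}.$$
   Context: For $n\in\mathbb N$, an inversion sequence of size $n$ is a sequence $\sigma=(\sigma_1,\dots,\sigma_n)\in\mathbb N^n$ with $\sigma_i<i$ for all $i$. An integer sequence contains a pattern $\rho$ (a finite integer sequence such as $100$ or $120$) if it has a subsequence order-isomorphic to $\rho$, and avoids $\rho$ otherwise. $\mathcal{I}_n(P)$ denotes the set of inversion sequences of size $n$ avoiding every pattern in the set $P$. $\mathcal W_{n,k}=\{0,\dots,k-1\}^n$ is the set of words of length $n$ over the alphabet $\{0,\dots,k-1\}$. $\max(\sigma)$ is the largest entry of $\sigma$. *)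

theory Defs
  imports Main "HOL-Library.Sublist"
begin

definition order_isomorphic :: "'a::linorder list \<Rightarrow> 'b::linorder list \<Rightarrow> bool" where
  "order_isomorphic xs ys \<longleftrightarrow> length xs = length ys \<and>
     (\<forall>i < length xs. \<forall>j < length xs. xs ! i < xs ! j \<longleftrightarrow> ys ! i < ys ! j)"

text \<open>\<^const>\<open>subseq\<close> is the relation of being a not necessarily contiguous subsequence.\<close>

definition contains_pattern :: "'a::linorder list \<Rightarrow> 'b::linorder list \<Rightarrow> bool" where
  "contains_pattern \<sigma> \<rho> \<longleftrightarrow> (\<exists>\<tau>. subseq \<tau> \<sigma> \<and> order_isomorphic \<tau> \<rho>)"

definition avoids_pattern :: "'a::linorder list \<Rightarrow> 'b::linorder list \<Rightarrow> bool" where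
  "avoids_pattern \<sigma> \<rho> \<longleftrightarrow> \<not> contains_pattern \<sigma> \<rho>"

text \<open>List positions start at 0, so the entry at list position \<open>i\<close> is \<open>\<sigma>\<^sub>i\<^sub>+\<^sub>1\<close>
  in one-based notation; hence the bound \<open>\<sigma> ! i < i + 1\<close>.\<close>

definition inversion_sequences :: "nat \<Rightarrow> nat list set" where
  "inversion_sequences n = {\<sigma>. length \<sigma> = n \<and> (\<forall>i < n. \<sigma> ! i < i + 1)}"

definition avoiding_inversion_sequences :: "nat \<Rightarrow> nat list set \<Rightarrow> nat list set" where
  "avoiding_inversion_sequences n P =
     {\<sigma> \<in> inversion_sequences n. \<forall>\<rho> \<in> P. avoids_pattern \<sigma> \<rho>}"

definition words :: "nat \<Rightarrow> nat \<Rightarrow> nat list set" where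
  "words n k = {\<omega>. length \<omega> = n \<and> set \<omega> \<subseteq> {0..<k}}"

text \<open>The maximum of the empty sequence is unspecified, so \<open>num_a 0 m\<close> carries no meaning.\<close>

definition num_a :: "nat \<Rightarrow> nat \<Rightarrow> nat" where
  "num_a n m = card {\<sigma> \<in> avoiding_inversion_sequences n {[1,0,0], [1,2,0]}. Max (set \<sigma>) = m}"

text \<open>For \<open>k = 0\<close> the truncated \<open>k - 1\<close> is harmless: only the empty word can occur then.\<close>

definition num_b :: "nat \<Rightarrow> nat \<Rightarrow> nat" where
  "num_b n k = card {\<omega> \<in> words n k. avoids_pattern \<omega> [1::nat,2,0] \<and>
     (\<forall>i < n. \<forall>j < n. \<omega> ! i = \<omega> ! j \<and> \<omega> ! j \<noteq> k - 1 \<longrightarrow> i = j)}"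

end

theory Submission
  imports Defs
begin

text \<open>Split an inversion sequence with maximum \<open>m > 0\<close> at the first occurrence of \<open>m\<close>, say at the
  one-based position \<open>p\<close>, and let \<open>j < m\<close> be the maximum of the part before it. Avoiding \<open>120\<close>
  forces every later entry to be at least \<open>j\<close> (use \<open>j\<close> and \<open>m\<close> as the letters 1 and 2), and
  avoiding \<open>100\<close> forbids repeated later entries other than \<open>m\<close>. Conversely these
  conditions suffice, because an occurrence of a pattern that straddles the cut would need a later
  entry below \<open>j\<close>, or an entry equal to \<open>j\<close> preceded by a larger one in the first part.
  Subtracting \<open>j\<close> from the later entries yields the words counted by \<^const>\<open>num_b\<close>.\<close>

section \<open>Pattern avoidance as conditions on subsequences\<close>

lemma order_isomorphic_triple_iff:
  "order_isomorphic \<tau> [a, b, c] \<longleftrightarrow> (\<exists>x y z. \<tau> = [x, y, z] \<and>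
    (x < y \<longleftrightarrow> a < b) \<and> (y < x \<longleftrightarrow> b < a) \<and> (x < z \<longleftrightarrow> a < c) \<and>
    (z < x \<longleftrightarrow> c < a) \<and> (y < z \<longleftrightarrow> b < c) \<and> (z < y \<longleftrightarrow> c < b))"
    (is "_ \<longleftrightarrow> (\<exists>x y z. \<tau> = [x, y, z] \<and> ?same x y z)")
proof -
  have "order_isomorphic [x, y, z] [a, b, c] \<longleftrightarrow> ?same x y z" for x y z
    by (simp add: order_isomorphic_def All_less_Suc) blast
  moreover have "\<exists>x y z. \<tau> = [x, y, z]" if "order_isomorphic \<tau> [a, b, c]"
    using that by (auto simp: order_isomorphic_def length_Suc_conv)
  ultimately show ?thesis by blast
qed

text \<open>In a linear order, two letters neither of which is below the other coincide, so the
  pattern's two equal letters force the shape \<open>[x, y, y]\<close>.\<close>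

lemma avoids_100_iff:
  "avoids_pattern \<sigma> [1::nat, 0, 0] \<longleftrightarrow> (\<forall>x y. subseq [x, y, y] \<sigma> \<longrightarrow> x \<le> y)"
proof -
  have "order_isomorphic \<tau> [1::nat, 0, 0] \<longleftrightarrow> (\<exists>x y. \<tau> = [x, y, y] \<and> y < x)"
    for \<tau> :: "'a list"
    by (auto simp: order_isomorphic_triple_iff not_less intro: antisym)
  then show ?thesis
    unfolding avoids_pattern_def contains_pattern_def by (auto simp flip: not_less)
qed

lemma avoids_120_iff:
  "avoids_pattern \<sigma> [1::nat, 2, 0] \<longleftrightarrow>
    (\<forall>x y z. subseq [x, y, z] \<sigma> \<longrightarrow> x < y \<longrightarrow> x \<le> z)"
proof -
  have "order_isomorphic \<tau> [1::nat, 2, 0] \<longleftrightarrow> (\<exists>x y z. \<tau> = [x, y, z] \<and> z < x \<and> x < y)"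
    for \<tau> :: "'a list"
    by (auto simp: order_isomorphic_triple_iff)
  then show ?thesis
    unfolding avoids_pattern_def contains_pattern_def by (auto simp flip: not_less)
qed

lemma avoids_pattern_subseq:
  "avoids_pattern \<sigma> \<rho> \<Longrightarrow> subseq \<tau> \<sigma> \<Longrightarrow> avoids_pattern \<tau> \<rho>"
  unfolding avoids_pattern_def contains_pattern_def
  by (blast intro: subseq_order.trans)

lemma set_mono_subseq: "subseq xs ys \<Longrightarrow> set xs \<subseteq> set ys"
  by (blast elim: list_emb_set)

text \<open>A subsequence is a choice of positions, and \<open>map\<close> keeps positions.\<close>

lemma subseq_map_iff: "subseq xs (map f ys) \<longleftrightarrow> (\<exists>zs. subseq zs ys \<and> xs = map f zs)"
  by (auto simp: subseq_conv_nths nths_map)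

text \<open>A strictly monotone map preserves and reflects \<open><\<close>, hence order
  isomorphism. This will be applied to the shift by \<open>j\<close>.\<close>

lemma avoids_pattern_map_strict_mono:
  assumes "strict_mono f"
  shows "avoids_pattern (map f \<sigma>) \<rho> \<longleftrightarrow> avoids_pattern \<sigma> \<rho>"
proof -
  have "order_isomorphic (map f \<tau>) \<rho> \<longleftrightarrow> order_isomorphic \<tau> \<rho>" for \<tau>
    using strict_mono_less[OF assms] by (auto simp: order_isomorphic_def)
  then show ?thesis
    unfolding avoids_pattern_def contains_pattern_def subseq_map_iff by blast
qed

lemma subseq_pair_iff_nth:
  "subseq [y, y] xs \<longleftrightarrow> (\<exists>i j. i < j \<and> j < length xs \<and> xs ! i = y \<and> xs ! j = y)"
proof (induction xs)
  case (Cons a xs)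
  have "(\<exists>i j. i < j \<and> j < length (a # xs) \<and> (a # xs) ! i = y \<and> (a # xs) ! j = y) \<longleftrightarrow>
    (a = y \<and> y \<in> set xs) \<or> (\<exists>i j. i < j \<and> j < length xs \<and> xs ! i = y \<and> xs ! j = y)"
    (is "?l \<longleftrightarrow> ?r")
  proof
    assume ?l
    \<comment> \<open>The larger index exceeds another one, so it is a successor; the smaller one is
      zero exactly when the head is part of the repetition.\<close>
    then obtain i j where "i < Suc j" "Suc j < length (a # xs)"
      "(a # xs) ! i = y" "(a # xs) ! Suc j = y"
      by (metis less_nat_zero_code old.nat.exhaust)
    then show ?r by (cases i) auto
  next
    assume ?r
    then show ?l
    proof
      assume "a = y \<and> y \<in> set xs"
      then obtain j where "j < length xs" "xs ! j = y" "a = y" by (auto simp: in_set_conv_nth)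
      then show ?l by (intro exI[of _ 0] exI[of _ "Suc j"]) auto
    next
      assume "\<exists>i j. i < j \<and> j < length xs \<and> xs ! i = y \<and> xs ! j = y"
      then obtain i j where "i < j" "j < length xs" "xs ! i = y" "xs ! j = y" by blast
      then show ?l by (intro exI[of _ "Suc i"] exI[of _ "Suc j"]) auto
    qed
  qed
  with Cons show ?case
    by (auto simp: subseq_singleton_left dest: subseq_Cons')
qed simp

text \<open>Translates the positional condition in \<open>num_b\<close> into the language of
  subsequences, where it can be combined with the pattern conditions.\<close>

lemma no_repeats_iff_subseq:
  "(\<forall>i < length xs. \<forall>j < length xs. xs ! i = xs ! j \<and> xs ! j \<noteq> c \<longrightarrow> i = j) \<longleftrightarrow>
    (\<forall>y. subseq [y, y] xs \<longrightarrow> y = c)"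
    (is "?l \<longleftrightarrow> ?r")
proof
  assume l: ?l
  show ?r
  proof (intro allI impI)
    fix y assume "subseq [y, y] xs"
    then obtain i j where ij: "i < j" "j < length xs" "xs ! i = y" "xs ! j = y"
      unfolding subseq_pair_iff_nth by blast
    then have "xs ! i = xs ! j \<and> xs ! j \<noteq> c \<longrightarrow> i = j"
      using l[rule_format, of i j] by auto
    then show "y = c" using ij by auto
  qed
next
  assume r: ?r
  have repeat: "xs ! j = c" if "i < j" "j < length xs" "xs ! i = xs ! j" for i j
  proof -
    have "subseq [xs ! j, xs ! j] xs"
      unfolding subseq_pair_iff_nth using that by blast
    with r show ?thesis by simp
  qed
  show ?l
  proof (intro allI impI)
    fix i j assume "i < length xs" "j < length xs" "xs ! i = xs ! j \<and> xs ! j \<noteq> c"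
    then show "i = j"
      using repeat[of i j] repeat[of j i] by (cases i j rule: linorder_cases) auto
  qed
qed

section \<open>Patterns in a sequence cut at an occurrence of its maximum\<close>

lemma subseq_triple_append_iff:
  "subseq [x, y, z] (us @ vs) \<longleftrightarrow>
    subseq [x, y, z] us \<or> (subseq [x, y] us \<and> z \<in> set vs) \<or>
    (x \<in> set us \<and> subseq [y, z] vs) \<or> subseq [x, y, z] vs"
  (is "?l \<longleftrightarrow> ?r")
proof
  assume ?l
  then obtain as bs where "[x, y, z] = as @ bs" "subseq as us" "subseq bs vs"
    by (auto simp: subseq_append_iff)
  then show ?r
    by (auto simp: Cons_eq_append_conv subseq_singleton_left)
next
  assume ?r
  then show ?l
    \<comment> \<open>One instance for each of the four places where the cut can fall in the
      triple.\<close>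
    using list_emb_append_mono[of "(=)" "[x, y, z]" us "[]" vs]
      list_emb_append_mono[of "(=)" "[x, y]" us "[z]" vs]
      list_emb_append_mono[of "(=)" "[x]" us "[y, z]" vs]
      list_emb_append_mono[of "(=)" "[]" us "[x, y, z]" vs]
    by (auto simp: subseq_singleton_left)
qed

text \<open>The right-hand side does not list avoidance of 100 by \<open>\<tau>\<close>, because it
  follows: only \<open>m\<close> may repeat there, and no letter of \<open>\<tau>\<close> exceeds
  \<open>m\<close>. The value \<open>j\<close> separates the two sides: letters before the cut are
  at most \<open>j\<close>, letters after it at least \<open>j\<close>.\<close>

lemma avoids_split_iff:
  fixes \<pi> \<tau> :: "nat list"
  assumes j: "j \<in> set \<pi>" "\<forall>x \<in> set \<pi>. x \<le> j" and "j < m" and \<tau>: "\<forall>x \<in> set \<tau>. x \<le> m"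
  shows "avoids_pattern (\<pi> @ m # \<tau>) [1::nat, 0, 0] \<and> avoids_pattern (\<pi> @ m # \<tau>) [1::nat, 2, 0]
    \<longleftrightarrow> avoids_pattern \<pi> [1::nat, 0, 0] \<and> avoids_pattern \<pi> [1::nat, 2, 0] \<and>
      avoids_pattern \<tau> [1::nat, 2, 0] \<and> (\<forall>y. subseq [y, y] \<tau> \<longrightarrow> y = m) \<and> (\<forall>y \<in> set \<tau>. j \<le> y)"
    (is "?l \<longleftrightarrow> ?r")
proof
  assume ?l
  have sub: "subseq \<pi> (\<pi> @ m # \<tau>)" "subseq \<tau> (\<pi> @ m # \<tau>)"
    by (auto intro: list_emb_prefix list_emb_append2)
  have "y = m" if "subseq [y, y] \<tau>" for y
  proof -
    \<comment> \<open>The \<open>m\<close> at the cut serves as the letter 1 of 100 for any smaller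
      letter repeated after it.\<close>
    have "subseq [m, y, y] (\<pi> @ m # \<tau>)"
      using that by (simp add: subseq_triple_append_iff)
    then have "m \<le> y" using \<open>?l\<close> unfolding avoids_100_iff by blast
    moreover have "y \<in> set \<tau>" using set_mono_subseq[OF that] by simp
    ultimately show ?thesis using \<tau> by (simp add: antisym)
  qed
  moreover have "j \<le> y" if "y \<in> set \<tau>" for y
  proof -
    have "subseq [j, m, y] (\<pi> @ m # \<tau>)"
      using that j by (simp add: subseq_triple_append_iff subseq_singleton_left)
    then show ?thesis using \<open>?l\<close> \<open>j < m\<close> unfolding avoids_120_iff by blast
  qed
  ultimately show ?r using \<open>?l\<close> sub avoids_pattern_subseq by blast
next
  assume r: ?r
  have mem: "x \<in> set vs" "y \<in> set vs" if "subseq [x, y] vs" for x y :: nat and vs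
    using set_mono_subseq[OF that] by simp_all
  have triple: "subseq [x, y, z] (m # \<tau>) \<longleftrightarrow>
      (x = m \<and> subseq [y, z] \<tau>) \<or> subseq [x, y, z] \<tau>" for x y z
    by (auto dest: subseq_Cons')
  have "x \<le> y" if "subseq [x, y, y] (\<pi> @ m # \<tau>)" for x y
  proof -
    from that consider "subseq [x, y, y] \<pi>" | "subseq [x, y] \<pi>" "y \<in> set (m # \<tau>)"
      | "x \<in> set \<pi>" "subseq [y, y] (m # \<tau>)" | "subseq [x, y, y] (m # \<tau>)"
      unfolding subseq_triple_append_iff by blast
    then show ?thesis
    proof cases
      case 1 then show ?thesis using r unfolding avoids_100_iff by blast
    next
      case 2
      then have "x \<le> j" "j \<le> y" using j r \<open>j < m\<close> mem by auto
      then show ?thesis by simp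
    next
      case 3
      then have "x \<le> j" "j \<le> y" using j r \<open>j < m\<close> mem(2)[OF 3(2)] by auto
      then show ?thesis by simp
    next
      case 4
      \<comment> \<open>Whether or not \<open>x\<close> is the \<open>m\<close> at the cut, both
        copies of \<open>y\<close> lie in \<open>\<tau>\<close>, so \<open>y\<close> is the maximum
        \<open>m\<close>.\<close>
      then have "subseq [y, y] \<tau>" unfolding triple by (blast dest: subseq_Cons')
      with r have "y = m" by blast
      with set_mono_subseq[OF 4] \<tau> show ?thesis by auto
    qed
  qed
  moreover have "x \<le> z" if "subseq [x, y, z] (\<pi> @ m # \<tau>)" "x < y" for x y z
  proof -
    from that consider "subseq [x, y, z] \<pi>" | "subseq [x, y] \<pi>" "z \<in> set (m # \<tau>)"
      | "x \<in> set \<pi>" "subseq [y, z] (m # \<tau>)" | "x = m" "subseq [y, z] \<tau>" | "subseq [x, y, z] \<tau>"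
      unfolding subseq_triple_append_iff triple by blast
    then show ?thesis
    proof cases
      case 1 then show ?thesis using r \<open>x < y\<close> unfolding avoids_120_iff by blast
    next
      case 2
      then have "x \<le> j" "j \<le> z" using j r \<open>j < m\<close> mem by auto
      then show ?thesis by simp
    next
      case 3
      then have "x \<le> j" "j \<le> z" using j r \<open>j < m\<close> mem(2)[OF 3(2)] by auto
      then show ?thesis by simp
    next
      case 4
      \<comment> \<open>Impossible case: \<open>x = m\<close> cannot be smaller than a letter of
        \<open>\<tau>\<close>.\<close>
      then show ?thesis using \<tau> mem(1)[OF 4(2)] \<open>x < y\<close> by auto
    next
      case 5 then show ?thesis using r \<open>x < y\<close> unfolding avoids_120_iff by blast
    qed
  qed
  ultimately show ?l unfolding avoids_100_iff avoids_120_iff by blast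
qed

section \<open>The sets counted by \<open>num_a\<close> and \<open>num_b\<close>\<close>

definition avoiders_with_max :: "nat \<Rightarrow> nat \<Rightarrow> nat list set" where
  "avoiders_with_max n m =
    {\<sigma> \<in> avoiding_inversion_sequences n {[1, 0, 0], [1, 2, 0]}. Max (set \<sigma>) = m}"

definition tail_words :: "nat \<Rightarrow> nat \<Rightarrow> nat list set" where
  "tail_words n k = {\<omega> \<in> words n k. avoids_pattern \<omega> [1::nat, 2, 0] \<and>
     (\<forall>i < n. \<forall>j < n. \<omega> ! i = \<omega> ! j \<and> \<omega> ! j \<noteq> k - 1 \<longrightarrow> i = j)}"

text \<open>Since \<open>0 < n\<close> the sequence is nonempty, so \<open>Max\<close> is a genuine
  maximum and can be replaced by its characterization.\<close>

lemma mem_avoiders_with_max_iff: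
  assumes "0 < n"
  shows "\<sigma> \<in> avoiders_with_max n m \<longleftrightarrow> length \<sigma> = n \<and> (\<forall>i < n. \<sigma> ! i \<le> i) \<and>
    m \<in> set \<sigma> \<and> (\<forall>x \<in> set \<sigma>. x \<le> m) \<and>
    avoids_pattern \<sigma> [1::nat, 0, 0] \<and> avoids_pattern \<sigma> [1::nat, 2, 0]"
proof (cases "length \<sigma> = n")
  case True
  with assms have "set \<sigma> \<noteq> {}" by auto
  then have "Max (set \<sigma>) = m \<longleftrightarrow> m \<in> set \<sigma> \<and> (\<forall>x \<in> set \<sigma>. x \<le> m)"
    by (simp add: Max_eq_iff)
  with True show ?thesis
    unfolding avoiders_with_max_def avoiding_inversion_sequences_def inversion_sequences_def
    by (auto simp: less_Suc_eq_le)
qed (simp add: avoiders_with_max_def avoiding_inversion_sequences_def inversion_sequences_def)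

text \<open>With alphabet size \<open>Suc d\<close>, the one letter allowed to repeat is
  \<open>d\<close>, and no truncated subtraction remains.\<close>

lemma mem_tail_words_iff:
  "\<omega> \<in> tail_words n (Suc d) \<longleftrightarrow> length \<omega> = n \<and> (\<forall>x \<in> set \<omega>. x \<le> d) \<and>
    avoids_pattern \<omega> [1::nat, 2, 0] \<and> (\<forall>y. subseq [y, y] \<omega> \<longrightarrow> y = d)"
  unfolding tail_words_def words_def
  by (auto simp: less_Suc_eq_le simp flip: no_repeats_iff_subseq)

lemma finite_avoiders_with_max: "finite (avoiders_with_max n m)"
proof (rule finite_subset)
  show "avoiders_with_max n m \<subseteq> {\<sigma>. set \<sigma> \<subseteq> {..n} \<and> length \<sigma> = n}"
    by (force simp: avoiders_with_max_def avoiding_inversion_sequences_def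
        inversion_sequences_def in_set_conv_nth)
qed (simp add: finite_lists_length_eq)

lemma finite_tail_words: "finite (tail_words n k)"
proof (rule finite_subset)
  show "tail_words n k \<subseteq> {\<omega>. set \<omega> \<subseteq> {0..<k} \<and> length \<omega> = n}"
    by (auto simp: tail_words_def words_def)
qed (simp add: finite_lists_length_eq)

section \<open>Gluing a prefix, the first maximum and a shifted word\<close>

definition glue :: "nat \<Rightarrow> nat \<Rightarrow> nat list \<Rightarrow> nat list \<Rightarrow> nat list" where
  "glue m j \<pi> \<omega> = \<pi> @ m # map (\<lambda>x. x + j) \<omega>"

text \<open>Here \<open>q\<close> is the zero-based position of the first \<open>m\<close>. The
  inversion bound only constrains the prefix: from position \<open>q\<close> on, all entries are at
  most \<open>m\<close>, and \<open>m \<le> q\<close>. The pattern conditions come from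
  \<open>avoids_split_iff\<close>; the shift by \<open>j\<close> carries the top letter
  \<open>m - j\<close> of the word to \<open>m\<close>.\<close>

lemma glue_mem_iff:
  assumes "0 < q" "length \<pi> = q" "j \<in> set \<pi>" "\<forall>x \<in> set \<pi>. x \<le> j" "j < m" "m \<le> q" "q < n"
    and \<omega>: "\<forall>x \<in> set \<omega>. x \<le> m - j"
  shows "glue m j \<pi> \<omega> \<in> avoiders_with_max n m \<longleftrightarrow>
    \<pi> \<in> avoiders_with_max q j \<and> \<omega> \<in> tail_words (n - Suc q) (Suc (m - j))"
proof -
  define \<tau> where "\<tau> = map (\<lambda>x. x + j) \<omega>"
  have \<tau>: "\<forall>x \<in> set \<tau>. j \<le> x \<and> x \<le> m" using \<omega> \<open>j < m\<close> by (force simp: \<tau>_def)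
  have avoid: "avoids_pattern \<tau> [1::nat, 2, 0] \<longleftrightarrow> avoids_pattern \<omega> [1::nat, 2, 0]"
    unfolding \<tau>_def by (rule avoids_pattern_map_strict_mono) (simp add: strict_mono_def)
  have repeats: "(\<forall>y. subseq [y, y] \<tau> \<longrightarrow> y = m) \<longleftrightarrow> (\<forall>y. subseq [y, y] \<omega> \<longrightarrow> y = m - j)"
    using \<open>j < m\<close> by (fastforce simp: \<tau>_def subseq_map_iff Cons_eq_map_conv)
  have bound: "(\<forall>i < n. (\<pi> @ m # \<tau>) ! i \<le> i) \<longleftrightarrow> (\<forall>i < q. \<pi> ! i \<le> i)"
    if len: "length (\<pi> @ m # \<tau>) = n"
  proof
    assume "\<forall>i < n. (\<pi> @ m # \<tau>) ! i \<le> i"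
    then show "\<forall>i < q. \<pi> ! i \<le> i" using assms by (metis less_trans nth_append)
  next
    assume \<pi>: "\<forall>i < q. \<pi> ! i \<le> i"
    show "\<forall>i < n. (\<pi> @ m # \<tau>) ! i \<le> i"
    proof (intro allI impI)
      fix i assume "i < n"
      show "(\<pi> @ m # \<tau>) ! i \<le> i"
      proof (cases "i < q")
        case True with \<pi> assms show ?thesis by (simp add: nth_append)
      next
        case False
        then have "(\<pi> @ m # \<tau>) ! i \<in> set (m # \<tau>)"
          using \<open>i < n\<close> len assms(2) by (auto simp: nth_append simp del: set_simps intro!: nth_mem)
        then have "(\<pi> @ m # \<tau>) ! i \<le> m" using \<tau> by auto
        with False \<open>m \<le> q\<close> show ?thesis by simp
      qed
    qed
  qed
  have len: "length (\<pi> @ m # \<tau>) = n \<longleftrightarrow> length \<omega> = n - Suc q"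
    using assms by (auto simp: \<tau>_def)
  have max: "m \<in> set (\<pi> @ m # \<tau>)" "\<forall>x \<in> set (\<pi> @ m # \<tau>). x \<le> m"
    using assms \<tau> by force+
  have n: "0 < n" using assms by simp
  show ?thesis
    unfolding glue_def \<tau>_def[symmetric] mem_avoiders_with_max_iff[OF n]
      mem_avoiders_with_max_iff[OF \<open>0 < q\<close>] mem_tail_words_iff
    using avoids_split_iff[of j \<pi> m \<tau>] avoid repeats bound len max \<tau> assms by blast
qed

text \<open>\<open>takeWhile\<close> recovers the part before the first \<open>a\<close>.\<close>

lemma append_Cons_unique_first:
  assumes "xs @ a # ys = xs' @ a # ys'" "a \<notin> set xs" "a \<notin> set xs'"
  shows "xs = xs' \<and> ys = ys'"
proof -
  have "takeWhile (\<lambda>x. x \<noteq> a) (us @ a # vs) = us" if "a \<notin> set us" for us vs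
    using that by (subst takeWhile_append2) auto
  then have "xs = xs'" using assms by metis
  with assms(1) show ?thesis by simp
qed

text \<open>The prefix is what precedes the first \<open>m\<close>, \<open>j\<close> is the greatest
  entry of the prefix, and undoing the shift by \<open>j\<close> gives the word.\<close>

lemma glue_inj:
  assumes "glue m j \<pi> \<omega> = glue m j' \<pi>' \<omega>'"
    and "j \<in> set \<pi>" "\<forall>x \<in> set \<pi>. x \<le> j" "j < m"
    and "j' \<in> set \<pi>'" "\<forall>x \<in> set \<pi>'. x \<le> j'" "j' < m"
  shows "\<pi> = \<pi>' \<and> j = j' \<and> \<omega> = \<omega>'"
proof -
  have "m \<notin> set \<pi>" "m \<notin> set \<pi>'" using assms by force+
  with assms(1) have eq: "\<pi> = \<pi>'" "map (\<lambda>x. x + j) \<omega> = map (\<lambda>x. x + j') \<omega>'"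
    by (auto simp: glue_def dest: append_Cons_unique_first)
  with assms have "j = j'" by (blast intro: antisym)
  with eq show ?thesis by (simp add: inj_map_eq_map inj_def)
qed

text \<open>The index \<open>p = q + 1\<close> is the one-based position of the first
  \<open>m\<close>, so \<open>m \<le> q < n\<close> becomes the range from \<open>m + 1\<close> to
  \<open>n\<close>.\<close>

lemma glue_bij_betw:
  assumes "0 < m" "m < n"
  shows "bij_betw (\<lambda>((p, j), (\<pi>, \<omega>)). glue m j \<pi> \<omega>)
    (SIGMA (p, j) : {m + 1..n} \<times> {0..m - 1}.
      avoiders_with_max (p - 1) j \<times> tail_words (n - p) (m - j + 1))
    (avoiders_with_max n m)" (is "bij_betw ?f ?S _")
proof (rule bij_betw_imageI)
  \<comment> \<open>From \<open>0 < m < p\<close> the prefix length \<open>p - 1\<close> is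
    positive, as \<open>mem_avoiders_with_max_iff\<close> requires.\<close>
  have dom: "m < p \<and> p \<le> n \<and> j < m \<and> length \<pi> = p - 1 \<and> j \<in> set \<pi> \<and> (\<forall>x \<in> set \<pi>. x \<le> j) \<and>
      \<pi> \<in> avoiders_with_max (p - 1) j \<and> \<omega> \<in> tail_words (n - p) (Suc (m - j))"
    if "((p, j), (\<pi>, \<omega>)) \<in> ?S" for p j \<pi> \<omega>
    using that assms by (auto simp: mem_avoiders_with_max_iff)
  show "inj_on ?f ?S"
  proof (rule inj_onI)
    fix s s' assume s: "s \<in> ?S" "s' \<in> ?S" and eq: "?f s = ?f s'"
    obtain p j \<pi> \<omega> p' j' \<pi>' \<omega>'
      where ss: "s = ((p, j), (\<pi>, \<omega>))" "s' = ((p', j'), (\<pi>', \<omega>'))"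
      by (metis surj_pair)
    note d = dom[OF s(1)[unfolded ss]] dom[OF s(2)[unfolded ss]]
    have "\<pi> = \<pi>' \<and> j = j' \<and> \<omega> = \<omega>'"
      using eq d by (intro glue_inj) (auto simp: ss)
    \<comment> \<open>The prefix length is \<open>p - 1\<close>, which determines \<open>p\<close>
      because \<open>p\<close> is positive.\<close>
    moreover from this have "p = p'" using d by auto
    ultimately show "s = s'" by (simp add: ss)
  qed
  show "?f ` ?S = avoiders_with_max n m"
  proof (intro equalityI subsetI)
    fix \<sigma> assume "\<sigma> \<in> ?f ` ?S"
    then obtain p j \<pi> \<omega> where mem: "((p, j), (\<pi>, \<omega>)) \<in> ?S" and \<sigma>: "\<sigma> = glue m j \<pi> \<omega>"
      by auto
    note d = dom[OF mem]
    have "glue m j \<pi> \<omega> \<in> avoiders_with_max n m"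
      by (subst glue_mem_iff[where q = "p - 1"]) (use d assms in \<open>auto simp: mem_tail_words_iff\<close>)
    then show "\<sigma> \<in> avoiders_with_max n m" by (simp add: \<sigma>)
  next
    fix \<sigma> assume \<sigma>: "\<sigma> \<in> avoiders_with_max n m"
    have n: "0 < n" using assms by simp
    note \<sigma>' = \<sigma>[unfolded mem_avoiders_with_max_iff[OF n]]
    from \<sigma>' obtain \<pi> \<tau> where split: "\<sigma> = \<pi> @ m # \<tau>" and "m \<notin> set \<pi>"
      by (meson split_list_first)
    define q where "q = length \<pi>"
    have "q < n" using \<sigma>' split by (auto simp: q_def)
    \<comment> \<open>The entry at \<open>q\<close> is the first \<open>m\<close>, so the inversion
      bound there yields \<open>m \<le> q\<close>; in particular the prefix is nonempty and has a
      maximum.\<close>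
    with \<sigma>' have "\<sigma> ! q \<le> q" by blast
    then have "m \<le> q" by (simp add: split q_def)
    with assms have "0 < q" "set \<pi> \<noteq> {}" by (auto simp: q_def)
    define j where "j = Max (set \<pi>)"
    have j: "j \<in> set \<pi>" "\<forall>x \<in> set \<pi>. x \<le> j"
      using \<open>set \<pi> \<noteq> {}\<close> by (auto simp: j_def)
    have \<tau>: "\<forall>x \<in> set \<tau>. x \<le> m" using \<sigma>' split by auto
    have "j \<le> m" using \<sigma>' split j(1) by auto
    then have "j < m" using \<open>m \<notin> set \<pi>\<close> j(1) by (metis le_neq_implies_less)
    have "\<forall>y \<in> set \<tau>. j \<le> y"
      using avoids_split_iff[OF j \<open>j < m\<close> \<tau>] \<sigma>' split by blast
    define \<omega> where "\<omega> = map (\<lambda>x. x - j) \<tau>"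
    \<comment> \<open>The subtraction defining \<open>\<omega>\<close> is never truncated, as all
      entries of \<open>\<tau>\<close> are at least \<open>j\<close>.\<close>
    have "map (\<lambda>x. x + j) \<omega> = \<tau>"
      using \<open>\<forall>y \<in> set \<tau>. j \<le> y\<close> by (simp add: \<omega>_def map_idI)
    then have glue: "\<sigma> = glue m j \<pi> \<omega>" by (simp add: glue_def split)
    have "\<forall>x \<in> set \<omega>. x \<le> m - j" using \<tau> by (auto simp: \<omega>_def diff_le_mono)
    then have "\<pi> \<in> avoiders_with_max q j \<and> \<omega> \<in> tail_words (n - Suc q) (Suc (m - j))"
      using glue_mem_iff[of q \<pi> j m n \<omega>] \<sigma> glue \<open>0 < q\<close> j \<open>j < m\<close> \<open>m \<le> q\<close> \<open>q < n\<close> q_def by blast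
    then have "((Suc q, j), (\<pi>, \<omega>)) \<in> ?S"
      using \<open>m \<le> q\<close> \<open>q < n\<close> \<open>j < m\<close> by auto
    then show "\<sigma> \<in> ?f ` ?S" using glue by force
  qed
qed

theorem theorem12:
  fixes m n :: nat
  assumes "0 < m" and "m < n"
  shows "num_a n m =
    (\<Sum>p = m + 1..n. \<Sum>j = 0..m - 1. num_a (p - 1) j * num_b (n - p) (m - j + 1))"
proof -
  have num_a: "num_a k l = card (avoiders_with_max k l)" for k l
    by (simp add: num_a_def avoiders_with_max_def)
  have num_b: "num_b k l = card (tail_words k l)" for k l
    by (simp add: num_b_def tail_words_def)
  have "num_a n m = card (SIGMA (p, j) : {m + 1..n} \<times> {0..m - 1}.
      avoiders_with_max (p - 1) j \<times> tail_words (n - p) (m - j + 1))"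
    unfolding num_a by (rule bij_betw_same_card[OF glue_bij_betw[OF assms], symmetric])
  also have "\<dots> = (\<Sum>(p, j) \<in> {m + 1..n} \<times> {0..m - 1}.
      card (avoiders_with_max (p - 1) j \<times> tail_words (n - p) (m - j + 1)))"
    \<comment> \<open>Finiteness of both factors is what allows summing over the fibres.\<close>
    by (subst card_SigmaI)
      (auto simp: finite_avoiders_with_max finite_tail_words case_prod_unfold)
  also have "\<dots> = (\<Sum>p = m + 1..n. \<Sum>j = 0..m - 1. num_a (p - 1) j * num_b (n - p) (m - j + 1))"
    by (simp add: card_cartesian_product num_a num_b sum.cartesian_product)
  finally show ?thesis .
qed

end
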